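(* The composition of the lower incomplete Riemann--Liouville fractional integral with the standard operation of differentiation is given by the following identities: $$\frac{\mathrm{d}}{\mathrm{d}x}\Big({}^{RL}_{0}D_x^{-\mu}[f(x);y]\Big)=\frac{y(1-y)^{\mu-1}}{\Gamma(\mu)}x^{\mu-1}f(xy)+{}^{RL}_{0}D^{1-\mu}_x[f(x);y],$$ $${}^{RL}_{0}D_x^{-\mu}[f'(x);y]=\frac{x^{\mu-1}}{\Gamma(\mu)}\left((1-y)^{\mu-1}f(xy)-f(0)\right)+{}^{RL}_{0}D^{1-\mu}_x[f(x);y],$$ valid for $\mu\in\mathbb{C}$ with $\mathrm{Re}(\mu)>1$ and for $f,x,y$ satisfying the criteria under which the lower incomplete Riemann--Liouville fractional integral is defined, namely $b>0$, $0<y<1$, $x\in[0,b]$, and $f:[0,b]\to\mathbb{C}$ a function which is $L^1$ on the subinterval $[0,yb]$.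
   Context: For $b>0$, $0<y<1$, $\nu\in\mathbb{C}$ with $\mathrm{Re}(\nu)>0$, and a function $h:[0,b]\to\mathbb{C}$ which is $L^1$ on $[0,yb]$, the lower incomplete Riemann--Liouville fractional integral of $h$ of order $\nu$ is $${}^{RL}_{0}D_x^{-\nu}[h(x);y]=\frac{1}{\Gamma(\nu)}\int_0^{yx}(x-t)^{\nu-1}h(t)\,\mathrm{d}t,\qquad x\in[0,b].$$ Thus ${}^{RL}_{0}D_x^{1-\mu}[f(x);y]$ is the integral of $f$ of order $\mu-1$, and ${}^{RL}_{0}D_x^{-\mu}[f'(x);y]$ is the integral of order $\mu$ applied to the derivative $f'$ of $f$.
   Formalization: The first identity is proved for almost every x in [0,b] and at every x where f is continuous at xy (one-sided derivative at 0 and b); the second assumes f' is L^1 on [0,yb] and f is differentiable everywhere on [0,yb] or absolutely continuous with a.e. derivative f'. *)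

theory Defs
  imports "HOL-Analysis.Analysis"
begin

(* The lower incomplete Riemann-Liouville fractional integral of order \<nu>, usually written as a
   differintegral of order -\<nu>; so the differintegral of order 1 - \<mu> is "incomplete_RL (\<mu> - 1)".
   The real bases of the complex powers are nonnegative, where powr is the principal power;
   powr gives 0 at base 0, which agrees with the mathematical value when Re exponent > 0. *)
definition incomplete_RL :: "complex \<Rightarrow> real \<Rightarrow> (real \<Rightarrow> complex) \<Rightarrow> real \<Rightarrow> complex" where
  "incomplete_RL \<nu> y h x =
     1 / Gamma \<nu> * (LINT t:{0..y * x}|lebesgue. of_real (x - t) powr (\<nu> - 1) * h t)"

definition absolutely_continuous_interval ::
    "real \<Rightarrow> real \<Rightarrow> (real \<Rightarrow> 'a::real_normed_vector) \<Rightarrow> bool" where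
  "absolutely_continuous_interval a b f \<longleftrightarrow>
     (\<forall>\<epsilon>>0. \<exists>\<delta>>0. \<forall>(n::nat) u v.
        (\<forall>i<n. a \<le> u i \<and> u i \<le> v i \<and> v i \<le> b) \<and>
        disjoint_family_on (\<lambda>i. {u i<..<v i}) {..<n} \<and>
        (\<Sum>i<n. v i - u i) < \<delta> \<longrightarrow>
        (\<Sum>i<n. norm (f (v i) - f (u i))) < \<epsilon>)"

(* g is "the derivative f'" of f on {a..b}: in the classical sense at every point (one-sided at
   the end points), or in the almost-everywhere sense for absolutely continuous f.  Almost
   everywhere differentiability alone would not suffice (Cantor function). *)
definition is_derivative_on ::
    "real \<Rightarrow> real \<Rightarrow> (real \<Rightarrow> 'a::real_normed_vector) \<Rightarrow> (real \<Rightarrow> 'a) \<Rightarrow> bool" where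
  "is_derivative_on a b f g \<longleftrightarrow>
     (\<forall>t\<in>{a..b}. (f has_vector_derivative g t) (at t within {a..b})) \<or>
     (absolutely_continuous_interval a b f \<and>
      (AE t in lebesgue. t \<in> {a..b} \<longrightarrow> (f has_vector_derivative g t) (at t within {a..b})))"

end

theory Submission
  imports Defs
begin

text \<open>For \<open>x > 0\<close> the truncation at \<open>y x\<close> keeps the kernel \<open>(x - t) powr (\<mu> - 1)\<close> smooth on the range of integration, so
both identities are, formally, the Leibniz rule and integration by parts. What needs care is that \<open>f\<close> is only
integrable and that its derivative may exist only almost everywhere.

For the first identity, the derivative of the integral at \<open>x > 0\<close> exists with the stated value as soon as the
primitive of \<open>f\<close> is differentiable at \<open>y x\<close> with derivative \<open>f (y x)\<close>; this is
\<open>truncated_convolution_has_vector_derivative\<close>. The condition holds at every point of continuity of \<open>f\<close>, and almost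
everywhere by Lebesgue's differentiation theorem, \<open>AE_indefinite_integral_has_vector_derivative\<close>, which
follows from the Henstock lemma and Vitali's covering lemma. Null sets of values \<open>y x\<close> pull back to null sets of \<open>x\<close>.
The point \<open>x = 0\<close> is settled by a direct estimate.

For the second identity, the product of \<open>f\<close> with the kernel is again either differentiable everywhere or absolutely
continuous (\<open>is_derivative_on_mult_smooth\<close>). In both cases its increment is the integral of its derivative
(\<open>is_derivative_on_has_integral\<close>), where the absolutely continuous case is proved directly with gauges. Both identities
then reduce to \<open>(\<mu> - 1) / \<Gamma>(\<mu>) = 1 / \<Gamma>(\<mu> - 1)\<close>.\<close>

section \<open>Lebesgue's differentiation theorem on an interval\<close>

lemma integral_diff_eq_increment:
  fixes f :: "real \<Rightarrow> 'a::banach"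
  assumes "f integrable_on {a..b}" "a \<le> u" "u \<le> v" "v \<le> b"
  shows "integral {u..v} f = integral {a..v} f - integral {a..u} f"
proof -
  have "f integrable_on {a..v}"
    using assms by (auto intro: integrable_on_subinterval)
  from Henstock_Kurzweil_Integration.integral_combine[OF assms(2,3) this]
  show ?thesis by (simp add: algebra_simps)
qed

text \<open>Each bad point \<open>x\<close> is the tag of an interval with endpoints \<open>x\<close> and \<open>z\<close>, as small as we like, on which
the Riemann term \<open>(z - x) f x\<close> misses the integral of \<open>f\<close> by more than \<open>e \<bar>z - x\<bar>\<close>. The Henstock lemma makes
the sum of such errors over any finite disjoint family fine for a suitable gauge as small as desired,
so these intervals have small total length. Vitali's covering lemma extracts a
disjoint family whose fivefold enlargements cover all bad points; hence the bad points have
arbitrarily small outer measure.\<close>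

lemma negligible_indefinite_integral_bad_points:
  fixes f :: "real \<Rightarrow> 'a::euclidean_space" and a b e :: real
  assumes f: "f integrable_on {a..b}" and "e > 0"
  defines "G \<equiv> \<lambda>s. integral {a..s} f"
  shows "negligible {x\<in>{a..b}. \<forall>d>0. \<exists>z\<in>{a..b}. \<bar>z - x\<bar> < d \<and>
           norm (G z - G x - (z - x) *\<^sub>R f x) > e * \<bar>z - x\<bar>}" (is "negligible ?E")
proof -
  define E where "E = ?E"
  have E: "x \<in> {a..b}" "\<And>d. d > 0 \<Longrightarrow> \<exists>z\<in>{a..b}. \<bar>z - x\<bar> < d \<and> norm (G z - G x - (z - x) *\<^sub>R f x) > e * \<bar>z - x\<bar>"
    if "x \<in> E" for x
    using that by (auto simp: E_def)
  have "negligible E"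
    unfolding negligible_outer_le
  proof (intro allI impI)
    fix \<eta> :: real assume "\<eta> > 0"
    \<comment> \<open>The 5 compensates for the enlargement of the intervals in the covering lemma.\<close>
    have "e * \<eta> / 5 > 0" using \<open>e > 0\<close> \<open>\<eta> > 0\<close> by simp
    with f obtain \<gamma> where "gauge \<gamma>" and \<gamma>: "\<And>p. \<lbrakk>p tagged_partial_division_of {a..b}; \<gamma> fine p\<rbrakk> \<Longrightarrow>
        (\<Sum>(x,k)\<in>p. norm (measure lborel k *\<^sub>R f x - integral k f)) < e * \<eta> / 5"
      using Henstock_lemma[where f = f and a = a and b = b and e = "e * \<eta> / 5"] unfolding box_real by blast
    have "\<exists>z\<in>{a..b}. norm (G z - G x - (z - x) *\<^sub>R f x) > e * \<bar>z - x\<bar> \<and> {min x z..max x z} \<subseteq> \<gamma> x"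
      if "x \<in> E" for x
    proof -
      obtain d where "d > 0" "ball x d \<subseteq> \<gamma> x"
        using \<open>gauge \<gamma>\<close> by (meson gauge_def open_contains_ball)
      with E(2)[OF that] obtain z where z: "z \<in> {a..b}" "\<bar>z - x\<bar> < d" "norm (G z - G x - (z - x) *\<^sub>R f x) > e * \<bar>z - x\<bar>"
        by blast
      have "{min x z..max x z} \<subseteq> ball x d"
        using z(2) by (auto simp: dist_real_def)
      with z \<open>ball x d \<subseteq> \<gamma> x\<close> show ?thesis by blast
    qed
    then have "\<exists>z. \<forall>x\<in>E. z x \<in> {a..b} \<and> norm (G (z x) - G x - (z x - x) *\<^sub>R f x) > e * \<bar>z x - x\<bar> \<and> {min x (z x)..max x (z x)} \<subseteq> \<gamma> x"
      by (intro bchoice) blast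
    then obtain z where z: "\<And>x. x \<in> E \<Longrightarrow> z x \<in> {a..b}"
        "\<And>x. x \<in> E \<Longrightarrow> norm (G (z x) - G x - (z x - x) *\<^sub>R f x) > e * \<bar>z x - x\<bar>"
        "\<And>x. x \<in> E \<Longrightarrow> {min x (z x)..max x (z x)} \<subseteq> \<gamma> x"
      by blast
    \<comment> \<open>The interval between \<open>x\<close> and \<open>z x\<close>, written as a ball because the covering lemma speaks of balls.\<close>
    define c where "c = (\<lambda>x. (x + z x) / 2)"
    define r where "r = (\<lambda>x. \<bar>z x - x\<bar> / 2)"
    have ball: "cball (c x) (r x) = {min x (z x)..max x (z x)}" for x
      unfolding cball_eq_atLeastAtMost
    proof (rule arg_cong2[where f = atLeastAtMost])
      show "c x - r x = min x (z x)" "c x + r x = max x (z x)"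
        unfolding c_def r_def by (simp_all add: min_def max_def abs_if field_simps)
    qed
    have zx: "z x \<noteq> x" if "x \<in> E" for x
      using z(2)[OF that] by auto
    have r: "0 < r x \<and> r x \<le> b - a" if "x \<in> E" for x
      using zx[OF that] z(1)[OF that] E(1)[OF that] by (simp add: r_def abs_if)
    have cov: "E \<subseteq> (\<Union>x\<in>E. cball (c x) (r x))"
    proof
      fix x assume "x \<in> E"
      moreover have "x \<in> cball (c x) (r x)" unfolding ball by simp
      ultimately show "x \<in> (\<Union>x\<in>E. cball (c x) (r x))" by blast
    qed
    obtain C where C: "countable C" "C \<subseteq> E"
        "pairwise (\<lambda>i j. disjnt (cball (c i) (r i)) (cball (c j) (r j))) C"
        "E \<subseteq> (\<Union>i\<in>C. cball (c i) (5 * r i))"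
      by (rule Vitali_covering_lemma_cballs[OF cov r], assumption, rule that)
    have le: "measure lebesgue (\<Union>x\<in>I. cball (c x) (5 * r x)) \<le> \<eta>" if I: "I \<subseteq> C" "finite I" for I
    proof -
      define p where "p = (\<lambda>x. (x, cball (c x) (r x))) ` I"
      have IE: "x \<in> E" if "x \<in> I" for x using that I C by blast
      have disj: "cball (c x) (r x) \<inter> cball (c x') (r x') = {}" if "x \<in> I" "x' \<in> I" "x \<noteq> x'" for x x'
        using pairwiseD[OF C(3)] I(1) that unfolding disjnt_def by blast
      have "p tagged_partial_division_of {a..b}"
        unfolding tagged_partial_division_of_def
      proof (intro conjI allI impI)
        show "finite p" using I by (simp add: p_def)
      next
        fix x K assume "(x, K) \<in> p"
        then have x: "x \<in> I" and K: "K = {min x (z x)..max x (z x)}" by (auto simp: p_def ball)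
        show "x \<in> K" "K \<subseteq> {a..b}"
          using K z(1)[OF IE[OF x]] E(1)[OF IE[OF x]] by (auto simp: min_def max_def)
        show "\<exists>u v. K = cbox u v"
          using K by (metis box_real(2))
      next
        fix x K x' K' assume *: "(x, K) \<in> p \<and> (x', K') \<in> p \<and> (x, K) \<noteq> (x', K')"
        then have "K \<inter> K' = {}" using disj by (auto simp: p_def)
        then show "interior K \<inter> interior K' = {}"
          using interior_subset by blast
      qed
      moreover have "\<gamma> fine p"
      proof (rule fineI)
        fix x K assume "(x, K) \<in> p"
        then have "x \<in> I" "K = {min x (z x)..max x (z x)}" by (auto simp: p_def ball)
        then show "K \<subseteq> \<gamma> x" using z(3)[OF IE] by blast
      qed
      ultimately have "(\<Sum>(x,k)\<in>p. norm (measure lborel k *\<^sub>R f x - integral k f)) < e * \<eta> / 5"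
        by (rule \<gamma>)
      also have "(\<Sum>(x,k)\<in>p. norm (measure lborel k *\<^sub>R f x - integral k f))
          = (\<Sum>x\<in>I. norm (measure lborel {min x (z x)..max x (z x)} *\<^sub>R f x - integral {min x (z x)..max x (z x)} f))"
        unfolding p_def ball by (subst sum.reindex) (simp_all add: inj_on_def)
      also have "\<dots> = (\<Sum>x\<in>I. norm (G (z x) - G x - (z x - x) *\<^sub>R f x))"
      proof (rule sum.cong[OF refl])
        fix x assume "x \<in> I"
        then have x: "x \<in> {a..b}" "z x \<in> {a..b}" using z(1)[OF IE] E(1)[OF IE] by blast+
        show "norm (measure lborel {min x (z x)..max x (z x)} *\<^sub>R f x - integral {min x (z x)..max x (z x)} f)
            = norm (G (z x) - G x - (z x - x) *\<^sub>R f x)"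
        proof (cases "x \<le> z x")
          case True
          then have "integral {x..z x} f = G (z x) - G x"
            unfolding G_def using x by (intro integral_diff_eq_increment[OF f]) auto
          then show ?thesis using True by (simp add: norm_minus_commute)
        next
          case False
          then have "integral {z x..x} f = G x - G (z x)"
            unfolding G_def using x by (intro integral_diff_eq_increment[OF f]) auto
          then have "measure lborel {z x..x} *\<^sub>R f x - integral {z x..x} f = G (z x) - G x - (z x - x) *\<^sub>R f x"
            using False by (simp add: algebra_simps)
          moreover have "min x (z x) = z x" "max x (z x) = x" using False by auto
          ultimately show ?thesis by (simp only:)
        qed
      qed
      finally have "(\<Sum>x\<in>I. norm (G (z x) - G x - (z x - x) *\<^sub>R f x)) < e * \<eta> / 5" .
      moreover have "(\<Sum>x\<in>I. e * \<bar>z x - x\<bar>) \<le> (\<Sum>x\<in>I. norm (G (z x) - G x - (z x - x) *\<^sub>R f x))"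
        by (intro sum_mono less_imp_le z(2) IE)
      ultimately have "e * (\<Sum>x\<in>I. \<bar>z x - x\<bar>) < e * (\<eta> / 5)"
        by (simp add: sum_distrib_left)
      then have *: "(\<Sum>x\<in>I. \<bar>z x - x\<bar>) < \<eta> / 5" by (rule mult_less_cancel_left_pos[OF \<open>e > 0\<close>, THEN iffD1])
      have "measure lebesgue (\<Union>x\<in>I. cball (c x) (5 * r x)) \<le> (\<Sum>x\<in>I. measure lebesgue (cball (c x) (5 * r x)))"
        by (rule measure_UNION_le[OF I(2)]) simp
      also have "\<dots> = (\<Sum>x\<in>I. 5 * \<bar>z x - x\<bar>)"
        by (rule sum.cong[OF refl]) (simp add: cball_eq_atLeastAtMost r_def)
      also have "\<dots> = 5 * (\<Sum>x\<in>I. \<bar>z x - x\<bar>)" by (simp add: sum_distrib_left)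
      finally show ?thesis using * by simp
    qed
    show "\<exists>T. E \<subseteq> T \<and> T \<in> lmeasurable \<and> measure lebesgue T \<le> \<eta>"
    proof (intro exI conjI)
      show "E \<subseteq> (\<Union>x\<in>C. cball (c x) (5 * r x))" by (rule C(4))
      show "(\<Union>x\<in>C. cball (c x) (5 * r x)) \<in> lmeasurable"
        by (rule fmeasurable_UN_bound[OF C(1) _ le]) auto
      show "measure lebesgue (\<Union>x\<in>C. cball (c x) (5 * r x)) \<le> \<eta>"
        by (rule measure_UN_bound[OF C(1) _ le]) auto
    qed
  qed
  then show ?thesis unfolding E_def .
qed

text \<open>Lebesgue's differentiation theorem on an interval. The points where the derivative fails lie in a
countable union of the sets of bad points with thresholds \<open>1 / (n + 1)\<close>.\<close>

theorem AE_indefinite_integral_has_vector_derivative: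
  fixes f :: "real \<Rightarrow> 'a::euclidean_space" and a b :: real
  assumes f: "f integrable_on {a..b}"
  obtains N where "negligible N"
    "\<And>x. \<lbrakk>x \<in> {a..b}; x \<notin> N\<rbrakk> \<Longrightarrow>
       ((\<lambda>s. integral {a..s} f) has_vector_derivative f x) (at x within {a..b})"
proof -
  define G where "G = (\<lambda>s. integral {a..s} f)"
  define E where "E e = {x\<in>{a..b}. \<forall>d>0. \<exists>z\<in>{a..b}. \<bar>z - x\<bar> < d \<and>
           norm (G z - G x - (z - x) *\<^sub>R f x) > e * \<bar>z - x\<bar>}" for e
  show ?thesis
  proof
    have *: "negligible (E e)" if "e > 0" for e
      unfolding E_def G_def by (rule negligible_indefinite_integral_bad_points[OF f that])
    show "negligible (\<Union>n. E (1 / real (Suc n)))"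
    proof (rule negligible_countable_Union)
      fix S assume "S \<in> range (\<lambda>n. E (1 / real (Suc n)))"
      then obtain n where "S = E (1 / real (Suc n))" by blast
      then show "negligible S" using * by simp
    qed simp
  next
    fix x assume x: "x \<in> {a..b}" "x \<notin> (\<Union>n. E (1 / real (Suc n)))"
    have "\<exists>d>0. \<forall>z\<in>{a..b}. norm (z - x) < d \<longrightarrow> norm (G z - G x - (z - x) *\<^sub>R f x) \<le> e * norm (z - x)"
      if "e > 0" for e
    proof -
      obtain n where n: "1 / real (Suc n) < e" using \<open>e > 0\<close> nat_approx_posE by blast
      obtain d where "d > 0"
        "\<And>z. \<lbrakk>z\<in>{a..b}; \<bar>z - x\<bar> < d\<rbrakk> \<Longrightarrow> norm (G z - G x - (z - x) *\<^sub>R f x) \<le> 1 / real (Suc n) * \<bar>z - x\<bar>"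
      proof -
        have "x \<notin> E (1 / real (Suc n))" using x(2) by blast
        then show ?thesis using x(1) that unfolding E_def mem_Collect_eq not_less[symmetric] by blast
      qed
      moreover have "1 / real (Suc n) * \<bar>z - x\<bar> \<le> e * \<bar>z - x\<bar>" for z
        using n by (intro mult_right_mono) auto
      ultimately show ?thesis unfolding real_norm_def by (blast intro: order_trans)
    qed
    then show "((\<lambda>s. integral {a..s} f) has_vector_derivative f x) (at x within {a..b})"
      unfolding has_vector_derivative_def has_derivative_within_alt G_def
      by (auto intro: bounded_linear_scaleR_left)
  qed
qed

section \<open>The fundamental theorem of calculus for absolutely continuous functions\<close>

text \<open>The definition speaks of families indexed by an initial segment of the natural numbers, whereas the
intervals of a tagged division are indexed by the division itself.\<close>

lemma absolutely_continuous_interval_finite_family: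
  assumes "absolutely_continuous_interval a b f" "\<epsilon> > 0"
  obtains \<delta> where "\<delta> > 0"
    "\<And>(I::'i set) u v. \<lbrakk>finite I; \<And>i. i \<in> I \<Longrightarrow> a \<le> u i \<and> u i \<le> v i \<and> v i \<le> b;
       disjoint_family_on (\<lambda>i. {u i<..<v i}) I; (\<Sum>i\<in>I. v i - u i) < \<delta>\<rbrakk>
       \<Longrightarrow> (\<Sum>i\<in>I. norm (f (v i) - f (u i))) < \<epsilon>"
proof -
  obtain \<delta> where "\<delta> > 0" and \<delta>': "\<forall>(n::nat) u v.
        (\<forall>i<n. a \<le> u i \<and> u i \<le> v i \<and> v i \<le> b) \<and>
        disjoint_family_on (\<lambda>i. {u i<..<v i}) {..<n} \<and>
        (\<Sum>i<n. v i - u i) < \<delta> \<longrightarrow>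
        (\<Sum>i<n. norm (f (v i) - f (u i))) < \<epsilon>"
    using assms(1)[unfolded absolutely_continuous_interval_def, rule_format, OF assms(2)] by (elim exE conjE)
  show ?thesis
  proof
    fix I :: "'i set" and u v
    assume I: "finite I" and uv: "\<And>i. i \<in> I \<Longrightarrow> a \<le> u i \<and> u i \<le> v i \<and> v i \<le> b"
      and disj: "disjoint_family_on (\<lambda>i. {u i<..<v i}) I" and less: "(\<Sum>i\<in>I. v i - u i) < \<delta>"
    obtain h where h: "bij_betw h {..<card I} I"
      using ex_bij_betw_nat_finite[OF I] by (auto simp: atLeast0LessThan)
    have hI: "h i \<in> I" if "i < card I" for i using h that by (auto simp: bij_betw_def)
    have "(\<Sum>i<card I. norm (f (v (h i)) - f (u (h i)))) < \<epsilon>"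
    proof (rule \<delta>'[rule_format], intro conjI allI impI)
      show "disjoint_family_on (\<lambda>i. {u (h i)<..<v (h i)}) {..<card I}"
        using disj h unfolding disjoint_family_on_def bij_betw_def inj_on_def
        by (metis imageI)
      show "(\<Sum>i<card I. v (h i) - u (h i)) < \<delta>"
        using less sum.reindex_bij_betw[OF h, of "\<lambda>i. v i - u i"] by simp
    qed (use uv hI in auto)
    then show "(\<Sum>i\<in>I. norm (f (v i) - f (u i))) < \<epsilon>"
      using sum.reindex_bij_betw[OF h, of "\<lambda>i. norm (f (v i) - f (u i))"] by simp
  qed fact
qed

lemma absolutely_continuous_interval_imp_continuous_on:
  assumes "absolutely_continuous_interval a b f"
  shows "continuous_on {a..b} f"
  unfolding continuous_on_iff
proof (intro ballI allI impI)
  fix x e :: real assume x: "x \<in> {a..b}" and "e > 0"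
  obtain \<delta> where "\<delta> > 0" and \<delta>: "\<And>(I::unit set) u v. \<lbrakk>finite I; \<And>i. i \<in> I \<Longrightarrow> a \<le> u i \<and> u i \<le> v i \<and> v i \<le> b;
       disjoint_family_on (\<lambda>i. {u i<..<v i}) I; (\<Sum>i\<in>I. v i - u i) < \<delta>\<rbrakk>
       \<Longrightarrow> (\<Sum>i\<in>I. norm (f (v i) - f (u i))) < e"
    using absolutely_continuous_interval_finite_family[OF assms \<open>e > 0\<close>] by blast
  have "norm (f z - f x) < e" if "z \<in> {a..b}" "\<bar>z - x\<bar> < \<delta>" for z
    using \<delta>[of "{()}" "\<lambda>_. min x z" "\<lambda>_. max x z"] x that
    by (cases "x \<le> z") (auto simp: disjoint_family_on_def norm_minus_commute)
  then show "\<exists>d>0. \<forall>x'\<in>{a..b}. dist x' x < d \<longrightarrow> dist (f x') (f x) < e"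
    using \<open>\<delta> > 0\<close> by (auto simp: dist_norm)
qed

text \<open>The local estimate behind gauge-integral proofs of the fundamental theorem: the tag \<open>x\<close> lies anywhere
between the endpoints, and the linearization at \<open>x\<close> is used once on each side.\<close>

lemma straddle:
  fixes f :: "real \<Rightarrow> 'a::real_normed_vector"
  assumes d: "\<And>z. \<lbrakk>z \<in> S; \<bar>z - x\<bar> < d\<rbrakk> \<Longrightarrow> norm (f z - f x - (z - x) *\<^sub>R D) \<le> e * \<bar>z - x\<bar>"
    and "{u..v} \<subseteq> S" "{u..v} \<subseteq> ball x d" "u \<le> x" "x \<le> v"
  shows "norm ((v - u) *\<^sub>R D - (f v - f u)) \<le> e * (v - u)"
proof -
  have "u \<in> {u..v}" "v \<in> {u..v}" using assms(4,5) by auto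
  with assms(2,3) have "u \<in> ball x d" "v \<in> ball x d" "u \<in> S" "v \<in> S" by blast+
  then have "\<bar>u - x\<bar> < d" "\<bar>v - x\<bar> < d" by (auto simp: dist_real_def)
  then have u: "norm (f u - f x - (u - x) *\<^sub>R D) \<le> e * (x - u)"
    and v: "norm (f v - f x - (v - x) *\<^sub>R D) \<le> e * (v - x)"
    using d[OF \<open>u \<in> S\<close>] d[OF \<open>v \<in> S\<close>] \<open>u \<le> x\<close> \<open>x \<le> v\<close> by (simp_all add: abs_minus_commute)
  have "(v - u) *\<^sub>R D - (f v - f u) = (f u - f x - (u - x) *\<^sub>R D) - (f v - f x - (v - x) *\<^sub>R D)"
    by (simp add: algebra_simps)
  then show ?thesis
    using norm_triangle_ineq4[of "f u - f x - (u - x) *\<^sub>R D" "f v - f x - (v - x) *\<^sub>R D"] u v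
    by (simp add: algebra_simps)
qed

text \<open>The gauge treats the two kinds of tags differently. At a point of differentiability it makes the
linearization accurate, so that these tags contribute an error proportional to \<open>b - a\<close>. At a point of the null
set \<open>N\<close> it confines the interval to an open set of measure less than \<open>\<delta>\<close>; the intervals tagged there have total
length below \<open>\<delta>\<close>, so absolute continuity bounds the increments of \<open>f\<close> over them.\<close>

theorem fundamental_theorem_of_calculus_absolutely_continuous:
  fixes f :: "real \<Rightarrow> 'a::banach"
  assumes ac: "absolutely_continuous_interval a b f" and "a \<le> b" and N: "negligible N"
    and deriv: "\<And>x. \<lbrakk>x \<in> {a..b}; x \<notin> N\<rbrakk> \<Longrightarrow> (f has_vector_derivative g x) (at x within {a..b})"
  shows "(g has_integral (f b - f a)) {a..b}"
proof -
  \<comment> \<open>Values on a null set do not affect the integral; with value 0, tags in \<open>N\<close> leave only the increments of \<open>f\<close>.\<close>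
  define g0 where "g0 = (\<lambda>x. if x \<in> N then 0 else g x)"
  have "(g0 has_integral (f b - f a)) {a..b}"
    unfolding has_integral_real
  proof (intro allI impI)
    fix e :: real assume "e > 0"
    define e' where "e' = e / (2 * (b - a + 1))"
    have "e' > 0" using \<open>e > 0\<close> \<open>a \<le> b\<close> by (simp add: e'_def)
    have "e' * (b - a) \<le> e / 2"
      using \<open>e > 0\<close> \<open>a \<le> b\<close> by (simp add: e'_def field_simps)
    have "\<exists>d>0. \<forall>z\<in>{a..b}. \<bar>z - x\<bar> < d \<longrightarrow> norm (f z - f x - (z - x) *\<^sub>R g x) \<le> e' * \<bar>z - x\<bar>"
      if "x \<in> {a..b}" "x \<notin> N" for x
      using deriv[OF that] \<open>e' > 0\<close>
      unfolding has_vector_derivative_def has_derivative_within_alt by (auto simp: real_norm_def)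
    then have "\<exists>d>0. x \<in> {a..b} - N \<longrightarrow> (\<forall>z\<in>{a..b}. \<bar>z - x\<bar> < d \<longrightarrow> norm (f z - f x - (z - x) *\<^sub>R g x) \<le> e' * \<bar>z - x\<bar>)" for x
      by (metis DiffD1 DiffD2 zero_less_one)
    then obtain d where d0: "\<And>x. d x > 0"
      and d: "\<And>x z. \<lbrakk>x \<in> {a..b} - N; z \<in> {a..b}; \<bar>z - x\<bar> < d x\<rbrakk> \<Longrightarrow> norm (f z - f x - (z - x) *\<^sub>R g x) \<le> e' * \<bar>z - x\<bar>"
      by metis
    obtain \<delta> where "\<delta> > 0"
      and \<delta>: "\<And>(I::(real \<times> real set) set) u v. \<lbrakk>finite I; \<And>i. i \<in> I \<Longrightarrow> a \<le> u i \<and> u i \<le> v i \<and> v i \<le> b;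
       disjoint_family_on (\<lambda>i. {u i<..<v i}) I; (\<Sum>i\<in>I. v i - u i) < \<delta>\<rbrakk>
       \<Longrightarrow> (\<Sum>i\<in>I. norm (f (v i) - f (u i))) < e / 2"
      using absolutely_continuous_interval_finite_family[OF ac half_gt_zero[OF \<open>e > 0\<close>]] by blast
    have "N \<in> sets lebesgue" using N by (simp add: negligible_imp_sets)
    obtain U where U: "open U" "N \<subseteq> U" "U \<in> lmeasurable" "measure lebesgue U < \<delta>"
    proof -
      from sets_lebesgue_outer_open[OF \<open>N \<in> sets lebesgue\<close> \<open>\<delta> > 0\<close>]
      obtain T where T: "open T" "N \<subseteq> T" "T - N \<in> lmeasurable" "emeasure lebesgue (T - N) < ennreal \<delta>"
        by auto
      have "T = (T - N) \<union> N" using T by auto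
      moreover have "measure lebesgue ((T - N) \<union> N) = measure lebesgue (T - N)"
        using N T(3) by (intro measure_Un_null_set) (auto simp: negligible_iff_null_sets)
      moreover have "measure lebesgue (T - N) < \<delta>"
        using T(4) \<open>\<delta> > 0\<close> T(3) by (simp add: emeasure_eq_measure2 ennreal_less_iff)
      moreover have "(T - N) \<union> N \<in> lmeasurable"
        by (rule fmeasurable.Un[OF T(3) negligible_imp_measurable[OF N]])
      ultimately show ?thesis using that T by metis
    qed
    define \<gamma> where "\<gamma> x = (if x \<in> N then U else ball x (d x))" for x
    have "gauge \<gamma>" using U d0 by (auto simp: gauge_def \<gamma>_def)
    have close: "norm ((\<Sum>(x,k)\<in>p. measure lborel k *\<^sub>R g0 x) - (f b - f a)) < e"
      if p: "p tagged_division_of {a..b}" and fine: "\<gamma> fine p" for p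
    proof -
      note pD = tagged_division_ofD[OF p]
      have KI: "K = {Inf K..Sup K}"
        and K: "a \<le> Inf K" "Inf K \<le> x" "x \<le> Sup K" "Sup K \<le> b" "K \<subseteq> \<gamma> x"
        if xK: "(x, K) \<in> p" for x K
      proof -
        obtain u v where uv: "K = {u..v}" "x \<in> K" "K \<subseteq> {a..b}" using pD xK by (metis box_real(2))
        then show "K = {Inf K..Sup K}" "a \<le> Inf K" "Inf K \<le> x" "x \<le> Sup K" "Sup K \<le> b"
          by auto
        show "K \<subseteq> \<gamma> x" using fine xK by (auto simp: fine_def)
      qed
      let ?err = "\<lambda>(x,K). measure lborel K *\<^sub>R g0 x - (f (Sup K) - f (Inf K))"
      define P where "P = {q\<in>p. fst q \<in> N}"
      have fin: "finite p" "finite P" using pD by (auto simp: P_def)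
      have "(\<Sum>(x,k)\<in>p. measure lborel k *\<^sub>R g0 x) - (f b - f a) = (\<Sum>q\<in>p. ?err q)"
        using additive_tagged_division_1[OF \<open>a \<le> b\<close> p, of f]
        by (simp add: sum_subtractf case_prod_unfold)
      also have "\<dots> = (\<Sum>q\<in>P. ?err q) + (\<Sum>q\<in>p - P. ?err q)"
        using fin by (subst sum.subset_diff[of P p]) (auto simp: P_def)
      finally have eq: "(\<Sum>(x,k)\<in>p. measure lborel k *\<^sub>R g0 x) - (f b - f a)
          = (\<Sum>q\<in>P. ?err q) + (\<Sum>q\<in>p - P. ?err q)" .
      have "norm (\<Sum>q\<in>P. ?err q) < e / 2"
      proof -
        have disj: "disjoint_family_on (\<lambda>q. {Inf (snd q)<..<Sup (snd q)}) P"
          unfolding disjoint_family_on_def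
        proof (intro ballI impI)
          fix q q' assume q: "q \<in> P" "q' \<in> P" "q \<noteq> q'"
          obtain x K x' K' where [simp]: "q = (x, K)" "q' = (x', K')" by fastforce
          have "interior K \<inter> interior K' = {}" using pD(5)[of x K x' K'] q by (auto simp: P_def)
          moreover have "interior K = {Inf K<..<Sup K}" "interior K' = {Inf K'<..<Sup K'}"
            using arg_cong[OF KI, of x K interior] arg_cong[OF KI, of x' K' interior] q by (auto simp: P_def)
          ultimately show "{Inf (snd q)<..<Sup (snd q)} \<inter> {Inf (snd q')<..<Sup (snd q')} = {}" by simp
        qed
        have PK: "a \<le> Inf (snd q) \<and> Inf (snd q) \<le> Sup (snd q) \<and> Sup (snd q) \<le> b \<and> {Inf (snd q)<..<Sup (snd q)} \<subseteq> U"
          if "q \<in> P" for q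
        proof -
          have q: "(fst q, snd q) \<in> p" "fst q \<in> N" using that by (auto simp: P_def)
          have "{Inf (snd q)<..<Sup (snd q)} \<subseteq> snd q"
            using KI[OF q(1)] greaterThanLessThan_subseteq_atLeastAtMost_iff by blast
          also have "\<dots> \<subseteq> U" using K(5)[OF q(1)] q(2) by (simp add: \<gamma>_def)
          finally show ?thesis using K(1-4)[OF q(1)] by linarith
        qed
        have "(\<Sum>q\<in>P. Sup (snd q) - Inf (snd q)) = (\<Sum>q\<in>P. measure lebesgue {Inf (snd q)<..<Sup (snd q)})"
          using PK by (intro sum.cong) auto
        also have "\<dots> = measure lebesgue (\<Union>q\<in>P. {Inf (snd q)<..<Sup (snd q)})"
          using disj fin by (intro measure_finite_Union[symmetric]) (use PK in auto)
        also have "\<dots> \<le> measure lebesgue U"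
          using PK U fin by (intro measure_mono_fmeasurable) auto
        finally have "(\<Sum>q\<in>P. norm (f (Sup (snd q)) - f (Inf (snd q)))) < e / 2"
          using U PK fin disj by (intro \<delta>) auto
        moreover have "norm (\<Sum>q\<in>P. ?err q) \<le> (\<Sum>q\<in>P. norm (f (Sup (snd q)) - f (Inf (snd q))))"
          by (rule sum_norm_le) (auto simp: P_def g0_def norm_minus_commute)
        ultimately show ?thesis by simp
      qed
      moreover have "norm (\<Sum>q\<in>p - P. ?err q) \<le> e / 2"
      proof -
        have "norm (\<Sum>q\<in>p - P. ?err q) \<le> (\<Sum>q\<in>p - P. e' * (Sup (snd q) - Inf (snd q)))"
        proof (rule sum_norm_le)
          fix q assume q: "q \<in> p - P"
          obtain x K where [simp]: "q = (x, K)" by fastforce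
          have xN: "x \<notin> N" and xK: "(x, K) \<in> p" using q by (auto simp: P_def)
          have "norm ((Sup K - Inf K) *\<^sub>R g x - (f (Sup K) - f (Inf K))) \<le> e' * (Sup K - Inf K)"
          proof (rule straddle[where S = "{a..b}" and d = "d x"])
            show "{Inf K..Sup K} \<subseteq> {a..b}" using K(1,4)[OF xK] by simp
            show "{Inf K..Sup K} \<subseteq> ball x (d x)"
              using K(5)[OF xK] xN unfolding KI[OF xK, symmetric] by (simp add: \<gamma>_def)
            have "x \<in> {a..b} - N" using K(1-4)[OF xK] xN by simp
            then show "norm (f z - f x - (z - x) *\<^sub>R g x) \<le> e' * \<bar>z - x\<bar>"
              if "z \<in> {a..b}" "\<bar>z - x\<bar> < d x" for z
              using d that by blast
          qed (use K(2,3)[OF xK] in blast)+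
          moreover have "measure lborel K = Sup K - Inf K"
            using arg_cong[OF KI[OF xK], of "measure lborel"] K(2,3)[OF xK] by simp
          ultimately show "norm (?err q) \<le> e' * (Sup (snd q) - Inf (snd q))"
            using xN by (simp add: g0_def)
        qed
        also have "\<dots> \<le> (\<Sum>q\<in>p. e' * (Sup (snd q) - Inf (snd q)))"
        proof (rule sum_mono2)
          show "0 \<le> e' * (Sup (snd q) - Inf (snd q))" if "q \<in> p - (p - P)" for q
            using K(2,3)[of "fst q" "snd q"] that \<open>e' > 0\<close> by (intro mult_nonneg_nonneg) auto
        qed (use fin in auto)
        also have "\<dots> = e' * (b - a)"
          using additive_tagged_division_1[OF \<open>a \<le> b\<close> p, of "\<lambda>x. x"]
          by (simp add: sum_distrib_left[symmetric] case_prod_unfold)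
        finally show ?thesis using \<open>e' * (b - a) \<le> e / 2\<close> by simp
      qed
      ultimately show ?thesis
        unfolding eq by (smt (verit) norm_triangle_ineq field_sum_of_halves)
    qed
    show "\<exists>\<gamma>. gauge \<gamma> \<and> (\<forall>p. p tagged_division_of {a..b} \<and> \<gamma> fine p \<longrightarrow>
        norm ((\<Sum>(x,k)\<in>p. measure lborel k *\<^sub>R g0 x) - (f b - f a)) < e)"
    proof (intro exI conjI allI impI)
      show "gauge \<gamma>" by fact
    qed (elim conjE, rule close)
  qed
  then show ?thesis
    by (rule has_integral_spike[OF N, rotated]) (auto simp: g0_def)
qed

corollary is_derivative_on_has_integral:
  fixes f :: "real \<Rightarrow> 'a::banach"
  assumes "is_derivative_on a b f g" "a \<le> b"
  shows "(g has_integral (f b - f a)) {a..b}"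
  using assms(1) unfolding is_derivative_on_def
proof
  assume "\<forall>t\<in>{a..b}. (f has_vector_derivative g t) (at t within {a..b})"
  then show ?thesis using \<open>a \<le> b\<close> by (intro fundamental_theorem_of_calculus) auto
next
  assume "absolutely_continuous_interval a b f \<and>
     (AE t in lebesgue. t \<in> {a..b} \<longrightarrow> (f has_vector_derivative g t) (at t within {a..b}))"
  then obtain N where "absolutely_continuous_interval a b f" "negligible N"
    "{t. \<not> (t \<in> {a..b} \<longrightarrow> (f has_vector_derivative g t) (at t within {a..b}))} \<subseteq> N"
    unfolding eventually_ae_filter_negligible by blast
  then show ?thesis
    using \<open>a \<le> b\<close> by (intro fundamental_theorem_of_calculus_absolutely_continuous[where N = N]) blast+
qed

lemma is_derivative_on_subinterval:
  assumes "is_derivative_on a b f g" "a \<le> c" "d \<le> b"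
  shows "is_derivative_on c d f g"
proof -
  have sub: "{c..d} \<subseteq> {a..b}" using assms by auto
  have deriv: "(f has_vector_derivative g t) (at t within {c..d})"
    if "t \<in> {c..d}" "t \<in> {a..b} \<longrightarrow> (f has_vector_derivative g t) (at t within {a..b})" for t
    using that sub has_vector_derivative_within_subset by blast
  have "absolutely_continuous_interval c d f" if "absolutely_continuous_interval a b f"
    using that assms(2,3) unfolding absolutely_continuous_interval_def by (meson order_trans)
  with assms(1) deriv show ?thesis
    unfolding is_derivative_on_def by (auto elim!: eventually_mono)
qed

text \<open>The increment of the product splits as \<open>k v (f v - f u) + (k v - k u) f u\<close>. With \<open>k\<close> and \<open>f\<close> bounded, absolute
continuity of \<open>f\<close> controls the first part and the total length of the intervals the second.\<close>

lemma absolutely_continuous_interval_mult_lipschitz: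
  fixes k f :: "real \<Rightarrow> 'a::real_normed_algebra"
  assumes f: "absolutely_continuous_interval a b f"
    and k: "L-lipschitz_on {a..b} k"
  shows "absolutely_continuous_interval a b (\<lambda>t. k t * f t)"
  unfolding absolutely_continuous_interval_def
proof (intro allI impI)
  fix \<epsilon> :: real assume "\<epsilon> > 0"
  have "bounded (f ` {a..b})" "bounded (k ` {a..b})"
    using absolutely_continuous_interval_imp_continuous_on[OF f] lipschitz_on_continuous_on[OF k]
    by (auto intro: compact_imp_bounded compact_continuous_image)
  then obtain M K where "M > 0" "K > 0" and M: "\<And>t. t \<in> {a..b} \<Longrightarrow> norm (f t) \<le> M"
    and K: "\<And>t. t \<in> {a..b} \<Longrightarrow> norm (k t) \<le> K"
    unfolding bounded_pos by auto
  have "L \<ge> 0" using k by (rule lipschitz_on_nonneg)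
  have "\<epsilon> / (2 * K) > 0" using \<open>\<epsilon> > 0\<close> \<open>K > 0\<close> by simp
  then obtain \<delta> where "\<delta> > 0" and \<delta>: "\<forall>(n::nat) u v.
        (\<forall>i<n. a \<le> u i \<and> u i \<le> v i \<and> v i \<le> b) \<and>
        disjoint_family_on (\<lambda>i. {u i<..<v i}) {..<n} \<and>
        (\<Sum>i<n. v i - u i) < \<delta> \<longrightarrow>
        (\<Sum>i<n. norm (f (v i) - f (u i))) < \<epsilon> / (2 * K)"
    using f[unfolded absolutely_continuous_interval_def, THEN spec, of "\<epsilon> / (2 * K)"]
    by auto
  define \<delta>' where "\<delta>' = min \<delta> (\<epsilon> / (2 * (L * M + 1)))"
  have "L * M + 1 > 0" using \<open>L \<ge> 0\<close> \<open>M > 0\<close> by (simp add: add_nonneg_pos)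
  have "\<delta>' > 0" using \<open>\<delta> > 0\<close> \<open>\<epsilon> > 0\<close> \<open>L * M + 1 > 0\<close> by (simp add: \<delta>'_def)
  moreover have "(\<Sum>i<n. norm (k (v i) * f (v i) - k (u i) * f (u i))) < \<epsilon>"
    if uv: "\<forall>i<n. a \<le> u i \<and> u i \<le> v i \<and> v i \<le> b"
      and disj: "disjoint_family_on (\<lambda>i. {u i<..<v i}) {..<n}"
      and less: "(\<Sum>i<n. v i - u i) < \<delta>'" for n :: nat and u v
  proof -
    have "(\<Sum>i<n. norm (k (v i) * f (v i) - k (u i) * f (u i)))
        \<le> (\<Sum>i<n. K * norm (f (v i) - f (u i)) + L * M * (v i - u i))"
    proof (rule sum_mono)
      fix i assume "i \<in> {..<n}"
      then have i: "u i \<in> {a..b}" "v i \<in> {a..b}" "u i \<le> v i" using uv by (auto intro: order_trans)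
      have "norm (k (v i) - k (u i)) \<le> L * (v i - u i)"
        using lipschitz_onD[OF k i(2,1)] i(3) by (simp add: dist_norm)
      have "k (v i) * f (v i) - k (u i) * f (u i) = k (v i) * (f (v i) - f (u i)) + (k (v i) - k (u i)) * f (u i)"
        by (simp add: algebra_simps)
      then have "norm (k (v i) * f (v i) - k (u i) * f (u i))
          \<le> norm (k (v i)) * norm (f (v i) - f (u i)) + norm (k (v i) - k (u i)) * norm (f (u i))"
        using norm_triangle_mono[OF norm_mult_ineq norm_mult_ineq] by metis
      also have "\<dots> \<le> K * norm (f (v i) - f (u i)) + (L * (v i - u i)) * M"
        using K M i \<open>norm (k (v i) - k (u i)) \<le> L * (v i - u i)\<close> \<open>L \<ge> 0\<close> \<open>K > 0\<close>
        by (intro add_mono mult_mono) auto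
      finally show "norm (k (v i) * f (v i) - k (u i) * f (u i)) \<le> K * norm (f (v i) - f (u i)) + L * M * (v i - u i)"
        by (simp add: algebra_simps)
    qed
    also have "\<dots> = K * (\<Sum>i<n. norm (f (v i) - f (u i))) + L * M * (\<Sum>i<n. v i - u i)"
      by (simp add: sum.distrib sum_distrib_left)
    also have "\<dots> < \<epsilon> / 2 + \<epsilon> / 2"
    proof (rule add_less_le_mono)
      have "(\<Sum>i<n. norm (f (v i) - f (u i))) < \<epsilon> / (2 * K)"
        using \<delta> uv disj less by (auto simp: \<delta>'_def)
      then show "K * (\<Sum>i<n. norm (f (v i) - f (u i))) < \<epsilon> / 2"
        using \<open>K > 0\<close> by (simp add: field_simps)
      have "L * M * (\<Sum>i<n. v i - u i) \<le> (L * M + 1) * (\<epsilon> / (2 * (L * M + 1)))"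
        using less uv \<open>L \<ge> 0\<close> \<open>M > 0\<close> by (intro mult_mono) (auto simp: \<delta>'_def intro!: sum_nonneg)
      also have "\<dots> = \<epsilon> / 2" using \<open>L * M + 1 > 0\<close> by (simp add: field_simps)
      finally show "L * M * (\<Sum>i<n. v i - u i) \<le> \<epsilon> / 2" .
    qed
    finally show ?thesis by simp
  qed
  ultimately show "\<exists>\<delta>>0. \<forall>(n::nat) u v.
        (\<forall>i<n. a \<le> u i \<and> u i \<le> v i \<and> v i \<le> b) \<and>
        disjoint_family_on (\<lambda>i. {u i<..<v i}) {..<n} \<and>
        (\<Sum>i<n. v i - u i) < \<delta> \<longrightarrow>
        (\<Sum>i<n. norm (k (v i) * f (v i) - k (u i) * f (u i))) < \<epsilon>"
    by blast
qed

text \<open>By compactness the derivative is bounded, and its bound serves as the Lipschitz constant.\<close>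

lemma continuous_derivative_imp_lipschitz_on:
  fixes k :: "real \<Rightarrow> 'a::real_normed_vector"
  assumes k: "\<And>t. t \<in> {a..b} \<Longrightarrow> (k has_vector_derivative k' t) (at t within {a..b})"
    and k': "continuous_on {a..b} k'"
  obtains L where "L > 0" "L-lipschitz_on {a..b} k"
proof -
  obtain L where "L > 0" and L: "\<And>t. t \<in> {a..b} \<Longrightarrow> norm (k' t) \<le> L"
    using compact_imp_bounded[OF compact_continuous_image[OF k' compact_Icc]] unfolding bounded_pos by auto
  have "L-lipschitz_on {a..b} k"
  proof (rule lipschitz_onI)
    fix s t assume st: "s \<in> {a..b}" "t \<in> {a..b}"
    have "norm (k s - k t) \<le> L * norm (s - t)"
    proof (rule differentiable_bound[where S = "{a..b}" and f' = "\<lambda>t h. h *\<^sub>R k' t"])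
      fix t assume t: "t \<in> {a..b}"
      show "onorm (\<lambda>h. h *\<^sub>R k' t) \<le> L"
        using L[OF t] by (intro onorm_le) (simp add: mult.commute[of L] mult_left_mono)
    qed (use st k in \<open>auto simp: has_vector_derivative_def\<close>)
    then show "dist (k s) (k t) \<le> L * dist s t" by (simp add: dist_norm)
  qed (use \<open>L > 0\<close> in simp)
  with \<open>L > 0\<close> show ?thesis by (rule that)
qed

text \<open>This product rule, together with the fundamental theorem above, gives integration by parts
against a smooth kernel for both readings of the derivative at once.\<close>

lemma is_derivative_on_mult_smooth:
  fixes k f :: "real \<Rightarrow> 'a::real_normed_algebra"
  assumes f: "is_derivative_on a b f f'"
    and k: "\<And>t. t \<in> {a..b} \<Longrightarrow> (k has_vector_derivative k' t) (at t within {a..b})"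
    and k': "continuous_on {a..b} k'"
  shows "is_derivative_on a b (\<lambda>t. k t * f t) (\<lambda>t. k t * f' t + k' t * f t)"
proof -
  obtain L where "L-lipschitz_on {a..b} k"
    using continuous_derivative_imp_lipschitz_on[OF k k'] by blast
  then show ?thesis
    using f absolutely_continuous_interval_mult_lipschitz[of a b f L k]
    unfolding is_derivative_on_def
    by (auto intro!: has_vector_derivative_mult k elim!: eventually_mono)
qed

section \<open>Differentiating a truncated convolution\<close>

text \<open>Uniform continuity of \<open>q'\<close> on the compact interval makes the scale \<open>\<delta>\<close> independent of the base point, so the
linearization can be used under an integral sign.\<close>

lemma continuous_derivative_imp_uniform_linearization:
  fixes q :: "real \<Rightarrow> 'a::real_normed_vector"
  assumes q: "\<And>r. r \<in> {c..d} \<Longrightarrow> (q has_vector_derivative q' r) (at r within {c..d})"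
    and q': "continuous_on {c..d} q'" and "\<epsilon> > 0"
  obtains \<delta> where "\<delta> > 0" "\<And>r s. \<lbrakk>r \<in> {c..d}; s \<in> {c..d}; \<bar>r - s\<bar> < \<delta>\<rbrakk> \<Longrightarrow>
      norm (q r - q s - (r - s) *\<^sub>R q' s) \<le> \<epsilon> * \<bar>r - s\<bar>"
proof -
  obtain \<delta> where "\<delta> > 0" and \<delta>: "\<And>r s. \<lbrakk>r \<in> {c..d}; s \<in> {c..d}; dist r s < \<delta>\<rbrakk> \<Longrightarrow> dist (q' r) (q' s) < \<epsilon>"
    by (rule uniformly_continuous_onE[OF compact_uniformly_continuous[OF q' compact_Icc] \<open>\<epsilon> > 0\<close>]) (rule that)
  show ?thesis
  proof
    fix r s assume rs: "r \<in> {c..d}" "s \<in> {c..d}" "\<bar>r - s\<bar> < \<delta>"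
    have sub: "closed_segment s r \<subseteq> {c..d}"
      using rs by (auto simp: closed_segment_eq_real_ivl)
    have "norm (q r - q s - (r - s) *\<^sub>R q' s) \<le> norm (r - s) * \<epsilon>"
    proof (rule vector_differentiable_bound_linearization[where S = "closed_segment s r"])
      show "(q has_vector_derivative q' t) (at t within closed_segment s r)" if "t \<in> closed_segment s r" for t
        using that sub q has_vector_derivative_within_subset by blast
      show "norm (q' t - q' s) \<le> \<epsilon>" if "t \<in> closed_segment s r" for t
      proof -
        have "\<bar>t - s\<bar> \<le> \<bar>r - s\<bar>"
          using that by (auto simp: closed_segment_eq_real_ivl split: if_splits)
        then show ?thesis
          using \<delta>[of t s] rs subsetD[OF sub that] by (simp add: dist_norm less_imp_le)
      qed
    qed auto
    then show "norm (q r - q s - (r - s) *\<^sub>R q' s) \<le> \<epsilon> * \<bar>r - s\<bar>" by (simp add: mult.commute)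
  qed fact
qed

lemma absolutely_integrable_continuous_mult:
  fixes w f :: "real \<Rightarrow> complex"
  assumes w: "continuous_on {u..v} w" and f: "f absolutely_integrable_on {a..b}" and sub: "a \<le> u" "v \<le> b"
  shows "(\<lambda>t. w t * f t) absolutely_integrable_on {u..v}"
proof -
  have "w \<in> borel_measurable (lebesgue_on {u..v})"
    by (rule continuous_imp_measurable_on_sets_lebesgue[OF w]) simp
  moreover have "bounded (w ` {u..v})"
    by (rule compact_imp_bounded[OF compact_continuous_image[OF w compact_Icc]])
  moreover have "f absolutely_integrable_on {u..v}"
    using sub by (intro absolutely_integrable_on_subinterval[OF f]) auto
  ultimately show ?thesis
    using absolutely_integrable_bounded_measurable_product[OF bilinear_times, of w "{u..v}" f] by simp
qed

text \<open>Taking the absolute value of the increment on the right allows \<open>u\<close> and \<open>v\<close> in either order, as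
is needed for two-sided difference quotients of an integral with a moving endpoint.\<close>

lemma norm_integral_increment_le:
  fixes w f :: "real \<Rightarrow> complex"
  assumes f: "f absolutely_integrable_on {a..b}" and uv: "u \<in> {a..b}" "v \<in> {a..b}"
    and w: "continuous_on {a..max u v} w" and \<eta>: "\<And>t. t \<in> {min u v..max u v} \<Longrightarrow> norm (w t) \<le> \<eta>"
  shows "norm (integral {a..u} (\<lambda>t. w t * f t) - integral {a..v} (\<lambda>t. w t * f t))
    \<le> \<eta> * \<bar>integral {a..u} (\<lambda>t. norm (f t)) - integral {a..v} (\<lambda>t. norm (f t))\<bar>"
proof -
  define W where "W = (\<lambda>s. integral {a..s} (\<lambda>t. w t * f t))"
  define N where "N = (\<lambda>s. integral {a..s} (\<lambda>t. norm (f t)))"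
  have *: "norm (W d - W c) \<le> \<eta> * \<bar>N d - N c\<bar>"
    if cd: "a \<le> c" "c \<le> d" "d \<le> b" and w: "continuous_on {a..d} w"
      and bound: "\<And>t. t \<in> {c..d} \<Longrightarrow> norm (w t) \<le> \<eta>" for c d
  proof -
    have wf: "(\<lambda>t. w t * f t) integrable_on {a..d}"
      by (rule set_lebesgue_integral_eq_integral(1)[OF absolutely_integrable_continuous_mult[OF w f order_refl cd(3)]])
    have "f absolutely_integrable_on {a..d}"
      using cd by (intro absolutely_integrable_on_subinterval[OF f]) simp
    then have nf: "(\<lambda>t. norm (f t)) integrable_on {a..d}"
      by (simp add: absolutely_integrable_on_def)
    have sub: "{c..d} \<subseteq> {a..d}" using cd by simp
    have "norm (integral {c..d} (\<lambda>t. w t * f t)) \<le> integral {c..d} (\<lambda>t. \<eta> * norm (f t))"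
    proof (rule integral_norm_bound_integral)
      show "(\<lambda>t. w t * f t) integrable_on {c..d}" by (rule integrable_on_subinterval[OF wf sub])
      show "(\<lambda>t. \<eta> * norm (f t)) integrable_on {c..d}"
        by (rule integrable_on_mult_right[OF integrable_on_subinterval[OF nf sub]])
      show "norm (w t * f t) \<le> \<eta> * norm (f t)" if "t \<in> {c..d}" for t
        unfolding norm_mult by (rule mult_right_mono[OF bound[OF that] norm_ge_zero])
    qed
    also have "\<dots> = \<eta> * integral {c..d} (\<lambda>t. norm (f t))" by simp
    also have "integral {c..d} (\<lambda>t. norm (f t)) = N d - N c"
      unfolding N_def using Henstock_Kurzweil_Integration.integral_combine[OF cd(1,2) nf] by simp
    also have "integral {c..d} (\<lambda>t. w t * f t) = W d - W c"
      unfolding W_def using Henstock_Kurzweil_Integration.integral_combine[OF cd(1,2) wf]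
      by (simp add: algebra_simps)
    finally have "norm (W d - W c) \<le> \<eta> * (N d - N c)" .
    moreover have "N c \<le> N d"
      unfolding N_def using cd
      by (intro integral_subset_le nf integrable_on_subinterval[OF nf]) simp_all
    ultimately show ?thesis by simp
  qed
  have "norm (W u - W v) \<le> \<eta> * \<bar>N u - N v\<bar>"
  proof (cases "v \<le> u")
    case True
    then show ?thesis using *[of v u] uv w \<eta> by (simp add: max_def min_def)
  next
    case False
    then have "norm (W v - W u) \<le> \<eta> * \<bar>N v - N u\<bar>" using *[of u v] uv w \<eta> by (simp add: max_def min_def)
    then show ?thesis by (simp only: norm_minus_commute abs_minus_commute)
  qed
  then show ?thesis unfolding W_def N_def .
qed

text \<open>A Leibniz rule for an integrand \<open>f\<close> that may be wildly discontinuous: the boundary term only sees the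
derivative of the primitive \<open>G\<close> of \<open>f\<close> at \<open>s0 = y * x0\<close>. Write \<open>F\<close> for the truncated convolution. Since \<open>y < 1\<close>, the arguments \<open>x - t\<close> stay in an
interval \<open>{c..b}\<close> with \<open>c > 0\<close> as long as \<open>x\<close> is close to \<open>x0\<close>, so the singularity of \<open>q\<close> at 0 is never met. The
idea is to subtract \<open>q (x0 - s0) * G (y * x)\<close>, which freezes the kernel at the moving endpoint and carries the
whole boundary term. For the remainder \<open>R\<close> one has

  \<open>R x - R x0 - (x - x0) A = \<integral>\<^sub>0\<^bsup>s0\<^esup> T f + (\<integral>\<^sub>0\<^bsup>y x\<^esup> w f - \<integral>\<^sub>0\<^bsup>s0\<^esup> w f)\<close>

where \<open>A\<close> is the integral of \<open>q' (x0 - t) f t\<close>, \<open>T\<close> is the linearization error of \<open>q\<close>, which is \<open>o(x - x0)\<close> uniformly in \<open>t\<close>,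
and \<open>w t = q (x - t) - q (x0 - s0)\<close> is \<open>O(x - x0)\<close> between the two endpoints. The last difference is \<open>o(x - x0)\<close>
because the integral of \<open>norm f\<close> is a continuous function of its upper limit.\<close>

theorem truncated_convolution_has_vector_derivative:
  fixes q q' f :: "real \<Rightarrow> complex"
  assumes y: "0 < y" "y < 1" and x0: "0 < x0" "x0 \<le> b"
    and f: "f absolutely_integrable_on {0..y * b}"
    and q: "\<And>r. r > 0 \<Longrightarrow> (q has_vector_derivative q' r) (at r)"
    and q': "continuous_on {0<..} q'"
    and G: "((\<lambda>s. integral {0..s} f) has_vector_derivative f (y * x0)) (at (y * x0) within {0..y * b})"
  shows "((\<lambda>x. integral {0..y * x} (\<lambda>t. q (x - t) * f t)) has_vector_derivative
      integral {0..y * x0} (\<lambda>t. q' (x0 - t) * f t) + q (x0 - y * x0) * (y *\<^sub>R f (y * x0)))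
      (at x0 within {0..b})"
proof -
  define s0 where "s0 = y * x0"
  \<comment> \<open>A lower bound for \<open>x - t\<close> valid for all \<open>x\<close> with \<open>\<bar>x - x0\<bar> < c\<close> and all \<open>t\<close> up to \<open>max (y * x) (y * x0)\<close>.\<close>
  define c where "c = (1 - y) * x0 / 2"
  define N where "N = (\<lambda>s. integral {0..s} (\<lambda>t. norm (f t)))"
  define G where "G = (\<lambda>s. integral {0..s} f)"
  define F where "F = (\<lambda>x. integral {0..y * x} (\<lambda>t. q (x - t) * f t))"
  define A where "A = integral {0..s0} (\<lambda>t. q' (x0 - t) * f t)"
  define q0 where "q0 = q (x0 - s0)"
  define R where "R = (\<lambda>x. F x - q0 * G (y * x))"
  have "c > 0" using y x0 by (simp add: c_def)
  have s0: "0 \<le> s0" "s0 \<le> y * b" "s0 < x0" using y x0 by (auto simp: s0_def)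
  have qJ: "(q has_vector_derivative q' r) (at r within {c..b})" if "r \<in> {c..b}" for r
    using that \<open>c > 0\<close> by (intro has_vector_derivative_at_within[OF q]) auto
  have q'J: "continuous_on {c..b} q'"
    using \<open>c > 0\<close> by (intro continuous_on_subset[OF q']) auto
  have qc: "continuous_on {0<..} q"
    using q by (auto simp: continuous_on_eq_continuous_at intro: has_vector_derivative_continuous)
  have shift: "continuous_on {0..v} (\<lambda>t. g (x - t))" if "continuous_on {0<..} g" "v < x" for g :: "real \<Rightarrow> complex" and x v
    using that by (intro continuous_on_compose2[OF that(1)] continuous_intros) auto
  have int: "(\<lambda>t. w t * f t) integrable_on {0..v}" if "continuous_on {0..v} w" "v \<le> y * b" for w v
    by (intro set_lebesgue_integral_eq_integral(1) absolutely_integrable_continuous_mult[OF that(1) f]) (use that in auto)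
  have fint: "f integrable_on {0..v}" "(\<lambda>t. norm (f t)) integrable_on {0..v}" if "v \<le> y * b" for v
    using f that by (auto simp: absolutely_integrable_on_def intro: integrable_on_subinterval)
  have R: "(R has_vector_derivative A) (at x0 within {0..b})"
    unfolding has_vector_derivative_def has_derivative_within_alt
  proof (intro conjI allI impI bounded_linear_scaleR_left)
    fix e :: real assume "e > 0"
    have "N s0 \<ge> 0" unfolding N_def by (intro integral_nonneg fint s0) simp
    obtain L where "L > 0" and L: "L-lipschitz_on {c..b} q"
      using continuous_derivative_imp_lipschitz_on[OF qJ q'J] by blast
    define \<epsilon> where "\<epsilon> = e / (2 * (N s0 + 1))"
    have "\<epsilon> > 0" "\<epsilon> * N s0 \<le> e / 2"
      using \<open>e > 0\<close> \<open>N s0 \<ge> 0\<close> by (auto simp: \<epsilon>_def field_simps)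
    obtain \<delta>1 where "\<delta>1 > 0" and \<delta>1: "\<And>r s. \<lbrakk>r \<in> {c..b}; s \<in> {c..b}; \<bar>r - s\<bar> < \<delta>1\<rbrakk> \<Longrightarrow>
      norm (q r - q s - (r - s) *\<^sub>R q' s) \<le> \<epsilon> * \<bar>r - s\<bar>"
      using continuous_derivative_imp_uniform_linearization[OF qJ q'J \<open>\<epsilon> > 0\<close>] by blast
    have contN: "continuous_on {0..y * b} N"
      unfolding N_def by (intro indefinite_integral_continuous_1 fint) simp
    have "e / (4 * L) > 0" using \<open>e > 0\<close> \<open>L > 0\<close> by simp
    then obtain \<delta>2 where "\<delta>2 > 0" and \<delta>2: "\<And>s. \<lbrakk>s \<in> {0..y * b}; \<bar>s - s0\<bar> < \<delta>2\<rbrakk> \<Longrightarrow> \<bar>N s - N s0\<bar> < e / (4 * L)"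
      using contN[unfolded continuous_on_iff dist_real_def, rule_format, of s0 "e / (4 * L)"] s0(1,2) by auto
    define d where "d = Min {\<delta>1, \<delta>2, c}"
    have "norm (R x - R x0 - (x - x0) *\<^sub>R A) \<le> e * norm (x - x0)"
      if x: "x \<in> {0..b}" "norm (x - x0) < d" for x
    proof -
      have d: "\<bar>x - x0\<bar> < \<delta>1" "\<bar>x - x0\<bar> < \<delta>2" "\<bar>x - x0\<bar> < c" using x by (auto simp: d_def)
      have yx: "y * x \<in> {0..y * b}" using x y by auto
      have "x > (1 + y) * x0 / 2" using d by (simp add: c_def abs_if field_simps split: if_splits)
      moreover have "(1 + y) * x0 / 2 - y * x0 = c" by (simp add: c_def field_simps)
      ultimately have arg1: "c < x - s0" by (simp add: s0_def)
      have arg2: "c \<le> x0 - s0"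
        using y x0 by (simp add: c_def s0_def field_simps)
      have "(1 - y) * ((1 + y) * x0 / 2) \<le> (1 - y) * x"
        using \<open>x > (1 + y) * x0 / 2\<close> y by (intro mult_left_mono) auto
      moreover have "c \<le> (1 - y) * ((1 + y) * x0 / 2)"
        using y x0 by (simp add: c_def field_simps)
      moreover have "(1 - y) * x = x - y * x" by (simp add: algebra_simps)
      ultimately have arg3: "c \<le> x - y * x" by linarith
      have xr: "x - t \<in> {c..b}" if "0 \<le> t" "t \<le> max s0 (y * x)" for t
        using that arg1 arg3 x by (auto simp: max_def split: if_splits)
      have xr0: "x0 - t \<in> {c..b}" if "0 \<le> t" "t \<le> s0" for t
        using that arg2 x0 by auto
      define w where "w = (\<lambda>t. q (x - t) - q0)"
      define T where "T = (\<lambda>t. q (x - t) - q (x0 - t) - (x - x0) *\<^sub>R q' (x0 - t))"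
      have "max s0 (y * x) < x" using arg1 arg3 \<open>c > 0\<close> by auto
      then have qx: "continuous_on {0..max s0 (y * x)} (\<lambda>t. q (x - t))"
        by (rule shift[OF qc])
      have qx0: "continuous_on {0..s0} (\<lambda>t. q (x0 - t))" "continuous_on {0..s0} (\<lambda>t. q' (x0 - t))"
        by (intro shift[OF qc] shift[OF q'] s0)+
      have qxs: "continuous_on {0..s0} (\<lambda>t. q (x - t))" "continuous_on {0..y * x} (\<lambda>t. q (x - t))"
        by (intro continuous_on_subset[OF qx]; auto)+
      have wint: "integral {0..v} (\<lambda>t. w t * f t) = integral {0..v} (\<lambda>t. q (x - t) * f t) - q0 * G v"
        if "v \<le> max s0 (y * x)" "v \<le> y * b" for v
      proof -
        have "continuous_on {0..v} (\<lambda>t. q (x - t))" using that by (intro continuous_on_subset[OF qx]) auto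
        then have "((\<lambda>t. q (x - t) * f t - q0 * f t) has_integral
            (integral {0..v} (\<lambda>t. q (x - t) * f t) - q0 * G v)) {0..v}"
          unfolding G_def
          by (intro has_integral_diff has_integral_mult_right integrable_integral int fint that(2))
        then show ?thesis
          unfolding w_def left_diff_distrib by (rule integral_unique)
      qed
      have Tint: "integral {0..s0} (\<lambda>t. T t * f t) = integral {0..s0} (\<lambda>t. q (x - t) * f t) - F x0 - (x - x0) *\<^sub>R A"
      proof -
        have "((\<lambda>t. q (x - t) * f t - q (x0 - t) * f t - (x - x0) *\<^sub>R (q' (x0 - t) * f t)) has_integral
            (integral {0..s0} (\<lambda>t. q (x - t) * f t) - F x0 - (x - x0) *\<^sub>R A)) {0..s0}"
          unfolding F_def A_def s0_def[symmetric]
          by (intro has_integral_diff has_integral_cmul integrable_integral int qxs qx0 s0)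
        moreover have "(\<lambda>t. q (x - t) * f t - q (x0 - t) * f t - (x - x0) *\<^sub>R (q' (x0 - t) * f t)) = (\<lambda>t. T t * f t)"
          by (simp add: T_def algebra_simps)
        ultimately show ?thesis by (simp only: integral_unique)
      qed
      have "R x - R x0 - (x - x0) *\<^sub>R A = integral {0..s0} (\<lambda>t. T t * f t)
          + (integral {0..y * x} (\<lambda>t. w t * f t) - integral {0..s0} (\<lambda>t. w t * f t))"
        using yx s0 by (simp add: Tint wint R_def F_def s0_def[symmetric])
      also have "norm \<dots> \<le> norm (integral {0..s0} (\<lambda>t. T t * f t))
          + norm (integral {0..y * x} (\<lambda>t. w t * f t) - integral {0..s0} (\<lambda>t. w t * f t))"
        by (rule norm_triangle_ineq)
      also have "\<dots> \<le> e / 2 * \<bar>x - x0\<bar> + e / 2 * \<bar>x - x0\<bar>"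
      proof (rule add_mono)
        have "norm (integral {0..s0} (\<lambda>t. T t * f t)) \<le> integral {0..s0} (\<lambda>t. \<epsilon> * \<bar>x - x0\<bar> * norm (f t))"
        proof (rule integral_norm_bound_integral)
          show "(\<lambda>t. T t * f t) integrable_on {0..s0}"
            unfolding T_def by (intro int continuous_intros qxs qx0 s0)
          show "(\<lambda>t. \<epsilon> * \<bar>x - x0\<bar> * norm (f t)) integrable_on {0..s0}"
            by (intro integrable_on_mult_right fint s0)
          fix t assume t: "t \<in> {0..s0}"
          then have t': "0 \<le> t" "t \<le> s0" "t \<le> max s0 (y * x)" by auto
          have "norm (T t) \<le> \<epsilon> * \<bar>x - x0\<bar>"
            using \<delta>1[OF xr[OF t'(1,3)] xr0[OF t'(1,2)]] d by (simp add: T_def)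
          then show "norm (T t * f t) \<le> \<epsilon> * \<bar>x - x0\<bar> * norm (f t)"
            by (simp add: norm_mult mult_right_mono)
        qed
        also have "\<dots> = (\<epsilon> * N s0) * \<bar>x - x0\<bar>" by (simp add: N_def)
        also have "\<dots> \<le> e / 2 * \<bar>x - x0\<bar>" using \<open>\<epsilon> * N s0 \<le> e / 2\<close> by (rule mult_right_mono) simp
        finally show "norm (integral {0..s0} (\<lambda>t. T t * f t)) \<le> e / 2 * \<bar>x - x0\<bar>" .
        have yd: "\<bar>y * x - s0\<bar> \<le> \<bar>x - x0\<bar>"
        proof -
          have "\<bar>y * x - s0\<bar> = y * \<bar>x - x0\<bar>" using y by (simp add: s0_def abs_mult right_diff_distrib[symmetric])
          also have "\<dots> \<le> 1 * \<bar>x - x0\<bar>" using y by (intro mult_right_mono) auto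
          finally show ?thesis by simp
        qed
        have "norm (integral {0..y * x} (\<lambda>t. w t * f t) - integral {0..s0} (\<lambda>t. w t * f t))
            \<le> (2 * L * \<bar>x - x0\<bar>) * \<bar>N (y * x) - N s0\<bar>"
          unfolding N_def
        proof (rule norm_integral_increment_le[OF f yx])
          show "s0 \<in> {0..y * b}" using s0 by simp
          show "continuous_on {0..max (y * x) s0} w"
            unfolding w_def max.commute[of "y * x"] by (intro continuous_intros qx)
          fix t assume t: "t \<in> {min (y * x) s0..max (y * x) s0}"
          have "0 \<le> t" "t \<le> max s0 (y * x)" using t yx s0 by auto
          then have "norm (w t) \<le> L * \<bar>(x - t) - (x0 - s0)\<bar>"
            using lipschitz_onD[OF L xr[of t] xr0[of s0]] s0 by (simp add: w_def q0_def dist_norm)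
          moreover have "\<bar>t - s0\<bar> \<le> \<bar>y * x - s0\<bar>" using t by (auto simp: min_def max_def split: if_splits)
          then have "\<bar>(x - t) - (x0 - s0)\<bar> \<le> 2 * \<bar>x - x0\<bar>"
            using yd abs_triangle_ineq4[of "x - x0" "t - s0"] by (simp add: algebra_simps)
          then have "L * \<bar>(x - t) - (x0 - s0)\<bar> \<le> L * (2 * \<bar>x - x0\<bar>)" using \<open>L > 0\<close> by simp
          ultimately show "norm (w t) \<le> 2 * L * \<bar>x - x0\<bar>" by simp
        qed
        also have "\<dots> \<le> (2 * L * \<bar>x - x0\<bar>) * (e / (4 * L))"
          using \<delta>2[OF yx] yd d \<open>L > 0\<close> by (intro mult_left_mono) auto
        also have "\<dots> = e / 2 * \<bar>x - x0\<bar>" using \<open>L > 0\<close> by (simp add: field_simps)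
        finally show "norm (integral {0..y * x} (\<lambda>t. w t * f t) - integral {0..s0} (\<lambda>t. w t * f t)) \<le> e / 2 * \<bar>x - x0\<bar>" .
      qed
      finally show ?thesis by simp
    qed
    moreover have "d > 0" using \<open>\<delta>1 > 0\<close> \<open>\<delta>2 > 0\<close> \<open>c > 0\<close> by (simp add: d_def)
    ultimately show "\<exists>d>0. \<forall>x\<in>{0..b}. norm (x - x0) < d \<longrightarrow> norm (R x - R x0 - (x - x0) *\<^sub>R A) \<le> e * norm (x - x0)"
      by blast
  qed
  have "(G \<circ> (\<lambda>x. y * x) has_vector_derivative y *\<^sub>R f (y * x0)) (at x0 within {0..b})"
  proof (rule vector_diff_chain_within)
    show "((\<lambda>x. y * x) has_vector_derivative y) (at x0 within {0..b})"
      by (auto intro!: derivative_eq_intros)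
    show "(G has_vector_derivative f (y * x0)) (at (y * x0) within (\<lambda>x. y * x) ` {0..b})"
      unfolding G_def using y by (intro has_vector_derivative_within_subset[OF G]) auto
  qed
  then have "((\<lambda>x. q0 * G (y * x)) has_vector_derivative q0 * (y *\<^sub>R f (y * x0))) (at x0 within {0..b})"
    unfolding o_def by (rule has_vector_derivative_mult_right)
  from has_vector_derivative_add[OF R this] show ?thesis
    by (simp add: R_def F_def A_def q0_def s0_def)
qed

section \<open>Incomplete Riemann-Liouville integrals\<close>

lemma of_real_powr_has_vector_derivative:
  assumes "r > 0"
  shows "((\<lambda>r. complex_of_real r powr s) has_vector_derivative s * of_real r powr (s - 1)) (at r within A)"
  using assms by (intro has_vector_derivative_real_field has_field_derivative_powr) simp

lemma continuous_on_of_real_powr: "continuous_on {0<..} (\<lambda>r. complex_of_real r powr s)"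
  unfolding continuous_on_eq_continuous_within
  by (blast intro: has_vector_derivative_continuous of_real_powr_has_vector_derivative)

text \<open>For \<open>x > 0\<close> the upper limit stays away from the singularity at \<open>t = x\<close>; for \<open>x = 0\<close> the interval is a point.\<close>

lemma continuous_on_RL_kernel:
  fixes x y :: real
  assumes "y < 1" "0 \<le> x"
  shows "continuous_on {0..y * x} (\<lambda>t. complex_of_real (x - t) powr s)"
proof (cases "x = 0")
  case False
  then have "y * x < x" using assms by simp
  then show ?thesis
    by (intro continuous_on_compose2[OF continuous_on_of_real_powr] continuous_intros) auto
qed simp

lemma RL_integrand_absolutely_integrable:
  fixes h :: "real \<Rightarrow> complex"
  assumes "0 < y" "y < 1" "h absolutely_integrable_on {0..y * b}" "x \<in> {0..b}"
  shows "(\<lambda>t. of_real (x - t) powr s * h t) absolutely_integrable_on {0..y * x}"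
  using assms by (intro absolutely_integrable_continuous_mult[OF continuous_on_RL_kernel assms(3)]) auto

lemma incomplete_RL_eq_integral:
  assumes "0 < y" "y < 1" "h absolutely_integrable_on {0..y * b}" "x \<in> {0..b}"
  shows "incomplete_RL \<nu> y h x
    = 1 / Gamma \<nu> * integral {0..y * x} (\<lambda>t. of_real (x - t) powr (\<nu> - 1) * h t)"
  unfolding incomplete_RL_def
  by (subst set_lebesgue_integral_eq_integral(2)[OF RL_integrand_absolutely_integrable[OF assms]]) simp

lemma Gamma_shift_down:
  assumes "Re \<mu> > 1"
  shows "(\<mu> - 1) / Gamma \<mu> = 1 / Gamma (\<mu> - 1)"
proof -
  have nonpole: "\<mu> - 1 \<notin> \<int>\<^sub>\<le>\<^sub>0" 
  proof
    assume "\<mu> - 1 \<in> \<int>\<^sub>\<le>\<^sub>0"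
    then obtain n where "\<mu> - 1 = of_int n" "n \<le> 0" by (rule nonpos_Ints_cases)
    then have "Re (\<mu> - 1) \<le> 0" by simp
    with assms show False by simp
  qed
  have "\<mu> - 1 \<noteq> 0" using assms by auto
  moreover have "Gamma \<mu> = (\<mu> - 1) * Gamma (\<mu> - 1)" using Gamma_plus1[OF nonpole] by simp
  ultimately show ?thesis by simp
qed

lemma of_real_scaled_powr:
  fixes x y :: real
  assumes "0 \<le> x" "y < 1"
  shows "complex_of_real (x - y * x) powr s = of_real (1 - y) powr s * of_real x powr s"
proof -
  have "complex_of_real (x - y * x) = of_real (1 - y) * of_real x" by (simp add: algebra_simps)
  then show ?thesis using assms powr_times_real[of "of_real (1 - y)" "of_real x" s] by simp
qed

text \<open>The Leibniz rule for the kernel \<open>r powr (\<mu> - 1)\<close>: differentiating the kernel lowers the order by one through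
\<open>(\<mu> - 1) / \<Gamma>(\<mu>) = 1 / \<Gamma>(\<mu> - 1)\<close>, and the boundary term factors since \<open>x - y x = (1 - y) x\<close>.\<close>

lemma incomplete_RL_has_vector_derivative:
  fixes b y x :: real and \<mu> :: complex and f :: "real \<Rightarrow> complex"
  assumes y: "0 < y" "y < 1" and \<mu>: "Re \<mu> > 1" and x: "0 < x" "x \<le> b"
    and f: "f absolutely_integrable_on {0..y * b}"
    and G: "((\<lambda>s. integral {0..s} f) has_vector_derivative f (y * x)) (at (y * x) within {0..y * b})"
  shows "(incomplete_RL \<mu> y f has_vector_derivative
      of_real y * of_real (1 - y) powr (\<mu> - 1) / Gamma \<mu> * of_real x powr (\<mu> - 1) * f (x * y)
      + incomplete_RL (\<mu> - 1) y f x) (at x within {0..b})"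
proof -
  define q where "q = (\<lambda>r. complex_of_real r powr (\<mu> - 1))"
  define q' where "q' = (\<lambda>r. (\<mu> - 1) * complex_of_real r powr (\<mu> - 1 - 1))"
  have "((\<lambda>x. integral {0..y * x} (\<lambda>t. q (x - t) * f t)) has_vector_derivative
      integral {0..y * x} (\<lambda>t. q' (x - t) * f t) + q (x - y * x) * (y *\<^sub>R f (y * x))) (at x within {0..b})"
  proof (rule truncated_convolution_has_vector_derivative[OF y x f _ _ G])
    show "(q has_vector_derivative q' r) (at r)" if "r > 0" for r
      unfolding q_def q'_def using that by (rule of_real_powr_has_vector_derivative)
    show "continuous_on {0<..} q'"
      unfolding q'_def by (intro continuous_intros continuous_on_of_real_powr)
  qed
  then have "((\<lambda>x. 1 / Gamma \<mu> * integral {0..y * x} (\<lambda>t. q (x - t) * f t)) has_vector_derivative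
      1 / Gamma \<mu> * (integral {0..y * x} (\<lambda>t. q' (x - t) * f t) + q (x - y * x) * (y *\<^sub>R f (y * x))))
      (at x within {0..b})"
    by (rule has_vector_derivative_mult_right)
  moreover have "1 / Gamma \<mu> * (integral {0..y * x} (\<lambda>t. q' (x - t) * f t) + q (x - y * x) * (y *\<^sub>R f (y * x)))
    = of_real y * of_real (1 - y) powr (\<mu> - 1) / Gamma \<mu> * of_real x powr (\<mu> - 1) * f (x * y)
      + incomplete_RL (\<mu> - 1) y f x"
  proof -
    have xb: "x \<in> {0..b}" using x by simp
    have "integral {0..y * x} (\<lambda>t. q' (x - t) * f t)
        = (\<mu> - 1) * integral {0..y * x} (\<lambda>t. of_real (x - t) powr (\<mu> - 1 - 1) * f t)"
      unfolding q'_def mult.assoc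
      by (intro integral_unique has_integral_mult_right integrable_integral
          set_lebesgue_integral_eq_integral(1)[OF RL_integrand_absolutely_integrable[OF y f xb]])
    then have "1 / Gamma \<mu> * integral {0..y * x} (\<lambda>t. q' (x - t) * f t)
        = (\<mu> - 1) / Gamma \<mu> * integral {0..y * x} (\<lambda>t. of_real (x - t) powr (\<mu> - 1 - 1) * f t)"
      by simp
    also have "\<dots> = incomplete_RL (\<mu> - 1) y f x"
      unfolding Gamma_shift_down[OF \<mu>] incomplete_RL_eq_integral[OF y f xb] ..
    finally have "1 / Gamma \<mu> * integral {0..y * x} (\<lambda>t. q' (x - t) * f t) = incomplete_RL (\<mu> - 1) y f x" .
    moreover have "q (x - y * x) = of_real (1 - y) powr (\<mu> - 1) * of_real x powr (\<mu> - 1)"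
      unfolding q_def using x y by (intro of_real_scaled_powr) auto
    ultimately show ?thesis
      by (simp add: distrib_left scaleR_conv_of_real mult.commute[of x y])
  qed
  moreover have "1 / Gamma \<mu> * integral {0..y * x} (\<lambda>t. q (x - t) * f t) = incomplete_RL \<mu> y f x"
    if "x \<in> {0..b}" for x
    unfolding incomplete_RL_eq_integral[OF y f that] q_def ..
  ultimately show ?thesis
    using x by (intro has_vector_derivative_transform[of x "{0..b}" "incomplete_RL \<mu> y f"]) auto
qed

text \<open>At the origin the kernel is singular at the moving endpoint, so the Leibniz rule does not apply. Instead, with \<open>f\<close>
bounded near 0, the integral is at most a constant times \<open>x powr (Re \<mu> - 1) * x\<close>, which is \<open>o(x)\<close> because \<open>Re \<mu> > 1\<close>.\<close>

lemma incomplete_RL_has_vector_derivative_at_0: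
  fixes b y :: real and \<mu> :: complex and f :: "real \<Rightarrow> complex"
  assumes y: "0 < y" "y < 1" and \<mu>: "Re \<mu> > 1" and "b > 0"
    and f: "f absolutely_integrable_on {0..y * b}"
    and cont: "continuous (at 0 within {0..y * b}) f"
  shows "(incomplete_RL \<mu> y f has_vector_derivative 0) (at 0 within {0..b})"
  unfolding has_vector_derivative_def has_derivative_within_alt
proof (intro conjI allI impI bounded_linear_scaleR_left)
  fix e :: real assume "e > 0"
  define a where "a = Re \<mu> - 1"
  have "a > 0" using \<mu> by (simp add: a_def)
  obtain \<delta> where "\<delta> > 0" and \<delta>: "\<And>t. \<lbrakk>t \<in> {0..y * b}; \<bar>t\<bar> < \<delta>\<rbrakk> \<Longrightarrow> dist (f t) (f 0) < 1"
    using cont[unfolded continuous_within_eps_delta, rule_format, of 1] by auto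
  define M where "M = norm (f 0) + 1"
  have M: "norm (f t) \<le> M" if "t \<in> {0..y * b}" "\<bar>t\<bar> < \<delta>" for t
    using \<delta>[OF that] norm_triangle_sub[of "f t" "f 0"] by (simp add: M_def dist_norm)
  define C where "C = norm (1 / Gamma \<mu>) * M"
  have "M > 0" by (simp add: M_def add_nonneg_pos)
  have "C \<ge> 0" using \<open>M > 0\<close> by (simp add: C_def)
  \<comment> \<open>Chosen so that \<open>C * d powr a \<le> e\<close>.\<close>
  define d where "d = min \<delta> ((e / (C + 1)) powr (1 / a))"
  have "d > 0" using \<open>\<delta> > 0\<close> \<open>e > 0\<close> \<open>C \<ge> 0\<close> by (simp add: d_def)
  have RL0: "incomplete_RL \<mu> y f 0 = 0"
    using incomplete_RL_eq_integral[OF y f, of 0] \<open>b > 0\<close> by simp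
  have "norm (incomplete_RL \<mu> y f x) \<le> e * x" if x: "x \<in> {0..b}" "\<bar>x\<bar> < d" for x
  proof -
    have yx: "0 \<le> y * x" "y * x \<le> x" "y * x \<le> y * b"
      using x y mult_right_mono[of y 1 x] by auto
    have "norm (integral {0..y * x} (\<lambda>t. of_real (x - t) powr (\<mu> - 1) * f t))
        \<le> integral {0..y * x} (\<lambda>t. x powr a * M)"
    proof (rule integral_norm_bound_integral)
      show "(\<lambda>t. of_real (x - t) powr (\<mu> - 1) * f t) integrable_on {0..y * x}"
        by (rule set_lebesgue_integral_eq_integral(1)[OF RL_integrand_absolutely_integrable[OF y f x(1)]])
      fix t assume t: "t \<in> {0..y * x}"
      have "norm (complex_of_real (x - t) powr (\<mu> - 1)) = (x - t) powr a"
        using t yx by (subst norm_powr_real_powr) (auto simp: a_def)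
      also have "\<dots> \<le> x powr a" using t yx \<open>a > 0\<close> by (intro powr_mono2) auto
      finally show "norm (of_real (x - t) powr (\<mu> - 1) * f t) \<le> x powr a * M"
        unfolding norm_mult using t yx x(2) \<open>M > 0\<close> by (intro mult_mono M) (auto simp: d_def)
    qed auto
    also have "\<dots> = x powr a * M * (y * x)" using yx by simp
    also have "\<dots> \<le> x powr a * M * x" using yx \<open>M > 0\<close> by (intro mult_left_mono) auto
    finally have "norm (1 / Gamma \<mu>) * norm (integral {0..y * x} (\<lambda>t. of_real (x - t) powr (\<mu> - 1) * f t))
        \<le> norm (1 / Gamma \<mu>) * (x powr a * M * x)"
      by (rule mult_left_mono) simp
    then have "norm (incomplete_RL \<mu> y f x) \<le> norm (1 / Gamma \<mu>) * (x powr a * M * x)"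
      unfolding incomplete_RL_eq_integral[OF y f x(1)] norm_mult .
    also have "\<dots> = (C * x powr a) * x" by (simp add: C_def mult_ac)
    also have "\<dots> \<le> e * x"
    proof (rule mult_right_mono)
      have "x powr a \<le> ((e / (C + 1)) powr (1 / a)) powr a"
        using x \<open>a > 0\<close> by (intro powr_mono2) (auto simp: d_def)
      also have "\<dots> = e / (C + 1)" using \<open>a > 0\<close> \<open>e > 0\<close> \<open>C \<ge> 0\<close> by (simp add: powr_powr)
      finally have "C * x powr a \<le> C * (e / (C + 1))" using \<open>C \<ge> 0\<close> by (rule mult_left_mono)
      also have "\<dots> \<le> e" using \<open>C \<ge> 0\<close> \<open>e > 0\<close> by (simp add: field_simps)
      finally show "C * x powr a \<le> e" .
    qed (use x in simp)
    finally show ?thesis .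
  qed
  then show "\<exists>d>0. \<forall>x\<in>{0..b}. norm (x - 0) < d \<longrightarrow>
      norm (incomplete_RL \<mu> y f x - incomplete_RL \<mu> y f 0 - (x - 0) *\<^sub>R 0) \<le> e * norm (x - 0)"
    using \<open>d > 0\<close> by (intro exI[of _ d]) (simp add: RL0)
qed

text \<open>Integration by parts: the kernel times \<open>f\<close> has increment
\<open>x powr (\<mu> - 1) * ((1 - y) powr (\<mu> - 1) * f (x y) - f 0)\<close> over \<open>{0..y x}\<close>, and the derivative of the kernel
produces the integral of order \<open>\<mu> - 1\<close>.\<close>

lemma incomplete_RL_of_derivative:
  fixes b y x :: real and \<mu> :: complex and f f' :: "real \<Rightarrow> complex"
  assumes y: "0 < y" "y < 1" and \<mu>: "Re \<mu> > 1"
    and f: "f absolutely_integrable_on {0..y * b}" and f': "f' absolutely_integrable_on {0..y * b}"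
    and deriv: "is_derivative_on 0 (y * b) f f'" and x: "x \<in> {0..b}"
  shows "incomplete_RL \<mu> y f' x =
    of_real x powr (\<mu> - 1) / Gamma \<mu> * (of_real (1 - y) powr (\<mu> - 1) * f (x * y) - f 0)
    + incomplete_RL (\<mu> - 1) y f x"
proof (cases "x = 0")
  case True
  then show ?thesis
    using incomplete_RL_eq_integral[OF y f x] incomplete_RL_eq_integral[OF y f' x] by simp
next
  case False
  with x have x0: "0 < x" by simp
  have yx: "0 \<le> y * x" "y * x < x" "y * x \<le> y * b" using x0 x y by auto
  define k where "k = (\<lambda>t. complex_of_real (x - t) powr (\<mu> - 1))"
  define k' where "k' = (\<lambda>t. - (\<mu> - 1) * complex_of_real (x - t) powr (\<mu> - 1 - 1))"
  define I where "I = integral {0..y * x} (\<lambda>t. k t * f' t)"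
  define J where "J = integral {0..y * x} (\<lambda>t. of_real (x - t) powr (\<mu> - 1 - 1) * f t)"
  have "is_derivative_on 0 (y * x) (\<lambda>t. k t * f t) (\<lambda>t. k t * f' t + k' t * f t)"
  proof (rule is_derivative_on_mult_smooth)
    show "is_derivative_on 0 (y * x) f f'"
      by (rule is_derivative_on_subinterval[OF deriv order_refl yx(3)])
    show "(k has_vector_derivative k' t) (at t within {0..y * x})" if "t \<in> {0..y * x}" for t
    proof -
      have "((\<lambda>t. x - t) has_vector_derivative -1) (at t within {0..y * x})"
        by (auto intro!: derivative_eq_intros)
      moreover have "((\<lambda>r. complex_of_real r powr (\<mu> - 1)) has_vector_derivative (\<mu> - 1) * of_real (x - t) powr (\<mu> - 1 - 1))
          (at (x - t) within (\<lambda>t. x - t) ` {0..y * x})"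
        using that yx by (intro of_real_powr_has_vector_derivative) auto
      ultimately have "((\<lambda>r. complex_of_real r powr (\<mu> - 1)) \<circ> (\<lambda>t. x - t) has_vector_derivative
          -1 *\<^sub>R ((\<mu> - 1) * of_real (x - t) powr (\<mu> - 1 - 1))) (at t within {0..y * x})"
        by (rule vector_diff_chain_within)
      then show ?thesis
        by (simp only: k_def k'_def o_def scaleR_minus_left scaleR_one mult_minus_left)
    qed
    show "continuous_on {0..y * x} k'"
      unfolding k'_def using x0 y by (intro continuous_intros continuous_on_RL_kernel) auto
  qed
  from is_derivative_on_has_integral[OF this yx(1)]
  have "((\<lambda>t. k t * f' t + k' t * f t) has_integral (k (y * x) * f (y * x) - k 0 * f 0)) {0..y * x}" .
  moreover have "((\<lambda>t. k t * f' t + k' t * f t) has_integral (I + - (\<mu> - 1) * J)) {0..y * x}"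
  proof (rule has_integral_add)
    show "((\<lambda>t. k t * f' t) has_integral I) {0..y * x}"
      unfolding I_def k_def
      by (intro integrable_integral set_lebesgue_integral_eq_integral(1)[OF RL_integrand_absolutely_integrable[OF y f' x]])
    have "((\<lambda>t. - (\<mu> - 1) * (of_real (x - t) powr (\<mu> - 1 - 1) * f t)) has_integral (- (\<mu> - 1) * J)) {0..y * x}"
      unfolding J_def
      by (intro has_integral_mult_right integrable_integral set_lebesgue_integral_eq_integral(1)[OF RL_integrand_absolutely_integrable[OF y f x]])
    then show "((\<lambda>t. k' t * f t) has_integral (- (\<mu> - 1) * J)) {0..y * x}"
      by (simp only: k'_def mult.assoc)
  qed
  ultimately have "I + - (\<mu> - 1) * J = k (y * x) * f (y * x) - k 0 * f 0"
    by (rule has_integral_unique[symmetric])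
  then have I: "I = k (y * x) * f (y * x) - k 0 * f 0 + (\<mu> - 1) * J" by (simp add: algebra_simps)
  have k: "k (y * x) = of_real (1 - y) powr (\<mu> - 1) * of_real x powr (\<mu> - 1)"
    "k 0 = of_real x powr (\<mu> - 1)"
    unfolding k_def using x0 y by (auto intro: of_real_scaled_powr simp del: of_real_diff)
  have RL\<mu>: "incomplete_RL \<mu> y f' x = 1 / Gamma \<mu> * I"
    unfolding I_def k_def by (rule incomplete_RL_eq_integral[OF y f' x])
  have RL\<mu>1: "incomplete_RL (\<mu> - 1) y f x = (\<mu> - 1) / Gamma \<mu> * J"
    unfolding J_def Gamma_shift_down[OF \<mu>] by (rule incomplete_RL_eq_integral[OF y f x])
  show ?thesis
    unfolding RL\<mu> RL\<mu>1 I k by (simp add: divide_inverse algebra_simps)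
qed

theorem theorem2p4:
  fixes b y :: real and \<mu> :: complex and f :: "real \<Rightarrow> complex"
  assumes "b > 0" and "0 < y" and "y < 1" and "Re \<mu> > 1"
    and "f absolutely_integrable_on {0..y * b}"
  defines "D \<equiv> \<lambda>x. of_real y * of_real (1 - y) powr (\<mu> - 1) / Gamma \<mu> *
                      of_real x powr (\<mu> - 1) * f (x * y) + incomplete_RL (\<mu> - 1) y f x"
  shows "(AE x in lebesgue. x \<in> {0..b} \<longrightarrow>
            (incomplete_RL \<mu> y f has_vector_derivative D x) (at x within {0..b})) \<and>
         (\<forall>x\<in>{0..b}. continuous (at (x * y) within {0..y * b}) f \<longrightarrow>
            (incomplete_RL \<mu> y f has_vector_derivative D x) (at x within {0..b})) \<and>
         (\<forall>f'. f' absolutely_integrable_on {0..y * b} \<and> is_derivative_on 0 (y * b) f f' \<longrightarrow>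
            (\<forall>x\<in>{0..b}. incomplete_RL \<mu> y f' x =
               of_real x powr (\<mu> - 1) / Gamma \<mu> *
                 (of_real (1 - y) powr (\<mu> - 1) * f (x * y) - f 0)
               + incomplete_RL (\<mu> - 1) y f x))"
proof (intro conjI ballI allI impI)
  note y = assms(2,3) and \<mu> = assms(4) and f = assms(5)
  have f_int: "f integrable_on {0..y * b}" by (rule set_lebesgue_integral_eq_integral(1)[OF f])
  have deriv: "(incomplete_RL \<mu> y f has_vector_derivative D x) (at x within {0..b})"
    if "0 < x" "x \<le> b"
      "((\<lambda>s. integral {0..s} f) has_vector_derivative f (y * x)) (at (y * x) within {0..y * b})" for x
    unfolding D_def by (rule incomplete_RL_has_vector_derivative[OF y \<mu> that(1,2) f that(3)])
  show "AE x in lebesgue. x \<in> {0..b} \<longrightarrow>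
      (incomplete_RL \<mu> y f has_vector_derivative D x) (at x within {0..b})"
  proof -
    obtain N where N: "negligible N" "\<And>s. \<lbrakk>s \<in> {0..y * b}; s \<notin> N\<rbrakk> \<Longrightarrow>
        ((\<lambda>s. integral {0..s} f) has_vector_derivative f s) (at s within {0..y * b})"
      using AE_indefinite_integral_has_vector_derivative[OF f_int] by blast
    \<comment> \<open>The exceptional points are those whose image under \<open>x \<mapsto> y x\<close> is exceptional for the primitive of \<open>f\<close>,
      and the origin, where the kernel degenerates.\<close>
    have "negligible (insert 0 ((\<lambda>s. s / y) ` N))"
      unfolding negligible_insert
    proof (rule negligible_differentiable_image_negligible[OF _ N(1)])
      show "(\<lambda>s. s / y) differentiable_on N"
        using y by (auto simp: differentiable_on_def intro!: differentiable_divide)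
    qed simp
    moreover have "(incomplete_RL \<mu> y f has_vector_derivative D x) (at x within {0..b})"
      if "x \<in> {0..b}" "x \<notin> insert 0 ((\<lambda>s. s / y) ` N)" for x
    proof -
      have "y * x \<notin> N"
      proof
        assume "y * x \<in> N"
        then have "y * x / y \<in> (\<lambda>s. s / y) ` N" by (rule imageI)
        then show False using that y by simp
      qed
      moreover have "y * x \<in> {0..y * b}" using that y by simp
      ultimately show ?thesis using that by (intro deriv N(2)) auto
    qed
    ultimately show ?thesis unfolding eventually_ae_filter_negligible by blast
  qed
  show "(incomplete_RL \<mu> y f has_vector_derivative D x) (at x within {0..b})"
    if x: "x \<in> {0..b}" and cont: "continuous (at (x * y) within {0..y * b}) f" for x
  proof (cases "x = 0")
    case True
    have "D 0 = 0"
      unfolding D_def using incomplete_RL_eq_integral[OF y f, of 0] \<open>b > 0\<close> by simp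
    then show ?thesis
      using incomplete_RL_has_vector_derivative_at_0[OF y \<mu> \<open>b > 0\<close> f] cont True by simp
  next
    case False
    have "y * x \<in> {0..y * b}" using x y by simp
    then have "((\<lambda>s. integral {0..s} f) has_vector_derivative f (y * x)) (at (y * x) within {0..y * b})"
      using integral_has_vector_derivative_continuous_at[OF f_int, of "y * x" "{}"] cont
      by (simp add: mult.commute)
    then show ?thesis using x False by (intro deriv) auto
  qed
  show "incomplete_RL \<mu> y f' x =
      of_real x powr (\<mu> - 1) / Gamma \<mu> * (of_real (1 - y) powr (\<mu> - 1) * f (x * y) - f 0)
      + incomplete_RL (\<mu> - 1) y f x"
    if "f' absolutely_integrable_on {0..y * b} \<and> is_derivative_on 0 (y * b) f f'" "x \<in> {0..b}" for f' x
    using that by (intro incomplete_RL_of_derivative[OF y \<mu> f]) auto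
qed

end
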